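(* Let $(G,\beta)$ be an edge-labeled graph (in the setting described in the context) with vertices $v_1,\dots,v_n$, let $(G_{red},\beta_{red})$ be the graph obtained from $(G,\beta)$ by successively taking reduced graphs associated to the vertices $v_n,v_{n-1},\dots,v_{i+1}$, and let $\psi:\hat R_G\to\hat R_{G_{red}}$, $\psi(f_{v_1},\dots,f_{v_n})=(f_{v_1},\dots,f_{v_i})$. Let $F^{(i)}=(0,\dots,0,f^{(i)}_{v_i},\dots,f^{(i)}_{v_n})$ be an $i$-th flow-up class of $\hat R_G$ (so $f^{(i)}_{v_i}\neq0$ and $f^{(i)}_{v_s}=0$ for $s<i$). Then $F^{(i)}$ is minimal (among $i$-th flow-up classes of $\hat R_G$) if and only if $\psi(F^{(i)})$ is minimal (among $i$-th flow-up classes of $\hat R_{G_{red}}$).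
   Context: Setting: $G$ is a finite connected simple graph. Each vertex $v$ is labeled by $M_v=m_v\mathbb{Z}$ ($m_v\in\mathbb{Z}$), each edge $e$ by $\mathbb{Z}/r_e\mathbb{Z}$ ($r_e\in\mathbb{Z}$). A spline is $f\in\prod_v M_v$ with $f_u-f_v\in r_e\mathbb{Z}$ for every edge $e=uv$; $\hat R_G$ is the $\mathbb{Z}$-module of splines. An $i$-th flow-up class is a spline $F$ with $f_{v_i}\neq0$ and $f_{v_s}=0$ for all $s<i$; its leading term $LT(F)$ is $f_{v_i}$. The leading terms of all $i$-th flow-up classes together with $0$ form an ideal of $\mathbb{Z}$; an $i$-th flow-up class is minimal if its leading term generates this ideal. $(a,b,\dots)$ denotes gcd and $[a,b,\dots]$ lcm. Reduced graph associated to a vertex $v$: (1) delete $v$ and its incident edges; each neighbor $w$ of $v$ is kept with vertex module replaced by $[m_w,(m_v,r_{vw})]\mathbb{Z}$; for each pair of distinct neighbors $w,w'$ of $v$ add an edge $ww'$ labeled $(r_{vw},r_{vw'})$; (2) replace any set of parallel edges with labels $r_1,\dots,r_k$ by a single edge labeled $[r_1,\dots,r_k]$. *)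

theory Defs
  imports Main "HOL-Library.FuncSet"
begin

text \<open>The vertex \<open>w\<close> carries the module \<open>vlab G w\<close> times \<open>\<int>\<close>, the edge \<open>e\<close>
  the module \<open>\<int>\<close> modulo \<open>elab G e\<close>. Labels are arbitrary integers (zero allowed).
  Edges are two-element sets of vertices.\<close>

record 'a lgraph =
  verts :: "'a set"
  edges :: "'a set set"
  vlab :: "'a \<Rightarrow> int"
  elab :: "'a set \<Rightarrow> int"

definition finite_connected_simple_graph :: "'a lgraph \<Rightarrow> bool" where
  "finite_connected_simple_graph G \<longleftrightarrow>
     finite (verts G) \<and> verts G \<noteq> {} \<and>
     (\<forall>e\<in>edges G. e \<subseteq> verts G \<and> card e = 2) \<and>
     (\<forall>u\<in>verts G. \<forall>w\<in>verts G. (u, w) \<in> {(x, y). {x, y} \<in> edges G}\<^sup>*)"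

definition multiples :: "int \<Rightarrow> int set" where
  "multiples a = {a * k | k. True}"

definition splines :: "'a lgraph \<Rightarrow> ('a \<Rightarrow> int) set" where
  "splines G = {f \<in> (\<Pi>\<^sub>E w\<in>verts G. multiples (vlab G w)).
     \<forall>u w. {u, w} \<in> edges G \<longrightarrow> f u - f w \<in> multiples (elab G {u, w})}"

text \<open>In the following, \<open>v 1, v 2, \<dots>\<close> is the enumeration of the vertices.\<close>

definition flow_up_class :: "'a lgraph \<Rightarrow> (nat \<Rightarrow> 'a) \<Rightarrow> nat \<Rightarrow> ('a \<Rightarrow> int) \<Rightarrow> bool" where
  "flow_up_class G v i F \<longleftrightarrow> F \<in> splines G \<and> F (v i) \<noteq> 0 \<and> (\<forall>s\<in>{1..<i}. F (v s) = 0)"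

definition leading_ideal :: "'a lgraph \<Rightarrow> (nat \<Rightarrow> 'a) \<Rightarrow> nat \<Rightarrow> int set" where
  "leading_ideal G v i = insert 0 {F (v i) | F. flow_up_class G v i F}"

definition minimal_flow_up_class ::
    "'a lgraph \<Rightarrow> (nat \<Rightarrow> 'a) \<Rightarrow> nat \<Rightarrow> ('a \<Rightarrow> int) \<Rightarrow> bool" where
  "minimal_flow_up_class G v i F \<longleftrightarrow>
     flow_up_class G v i F \<and> multiples (F (v i)) = leading_ideal G v i"

text \<open>The labels of all parallel edges with endpoint set \<open>e\<close> that are present after deleting
  \<open>x\<close> and joining its neighbours pairwise, before parallel edges are merged.\<close>

definition parallel_labels :: "'a lgraph \<Rightarrow> 'a \<Rightarrow> 'a set \<Rightarrow> int set" where
  "parallel_labels G x e =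
     (if e \<in> edges G \<and> x \<notin> e then {elab G e} else {}) \<union>
     {gcd (elab G {x, w}) (elab G {x, w'}) | w w'.
        w \<noteq> w' \<and> {x, w} \<in> edges G \<and> {x, w'} \<in> edges G \<and> e = {w, w'}}"

text \<open>An edge without parallels gets the \<open>Lcm\<close> of a singleton, i.e. the absolute value of its
  label, which generates the same ideal.\<close>

definition reduced_graph :: "'a lgraph \<Rightarrow> 'a \<Rightarrow> 'a lgraph" where
  "reduced_graph G x =
     \<lparr> verts = verts G - {x},
       edges = {e. parallel_labels G x e \<noteq> {}},
       vlab = (\<lambda>w. if {x, w} \<in> edges G
                   then lcm (vlab G w) (gcd (vlab G x) (elab G {x, w})) else vlab G w),
       elab = (\<lambda>e. Lcm (parallel_labels G x e)) \<rparr>"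

text \<open>Reduces at \<open>v n\<close> first, then \<open>v (n - 1)\<close>, and finally at \<open>v (i + 1)\<close>.\<close>

definition successive_reduction :: "'a lgraph \<Rightarrow> (nat \<Rightarrow> 'a) \<Rightarrow> nat \<Rightarrow> nat \<Rightarrow> 'a lgraph" where
  "successive_reduction G v n i =
     fold (\<lambda>j H. reduced_graph H (v j)) (rev [i + 1..<n + 1]) G"

definition spline_projection :: "(nat \<Rightarrow> 'a) \<Rightarrow> nat \<Rightarrow> ('a \<Rightarrow> int) \<Rightarrow> 'a \<Rightarrow> int" where
  "spline_projection v i f = restrict f (v ` {1..i})"

end

theory Submission
  imports Defs "HOL-Computational_Algebra.Euclidean_Algorithm"
begin

text \<open>Restriction maps the splines of \<open>G\<close> onto the splines of the reduced graph at \<open>x\<close>.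
  The value at \<open>x\<close> has to solve a system of congruences whose moduli are the label of \<open>x\<close>
  and the labels of the edges at \<open>x\<close>, and by the Chinese remainder theorem for arbitrary
  moduli this system is solvable iff it is so pairwise; the labels of the reduced graph express
  exactly this pairwise solvability. Hence the leading ideals of both graphs coincide.\<close>

lemma mem_multiples_iff: "b \<in> multiples a \<longleftrightarrow> a dvd b"
  by (auto simp: multiples_def dvd_def)

text \<open>Bezout splits \<open>a - b\<close> into a multiple of \<open>r\<close> plus a multiple
  of \<open>s\<close>; moving the multiple of \<open>r\<close> over to \<open>a\<close> gives
  \<open>z\<close>.\<close>

lemma two_congruences:
  fixes a b r s :: int
  assumes "gcd r s dvd a - b"
  obtains z where "r dvd z - a" "s dvd z - b"
proof -
  obtain k where k: "a - b = gcd r s * k"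
    using assms by blast
  obtain u w where "u * r + w * s = gcd r s"
    using bezout_int by blast
  then have "a - b = (u * r + w * s) * k"
    using k by simp
  then have "a - u * r * k - b = s * (w * k)"
    by (simp add: algebra_simps)
  then show thesis
    by (intro that[of "a - u * r * k"]) auto
qed

text \<open>Induction on \<open>I\<close>: the old congruences say that \<open>z\<close> is fixed
  modulo the \<open>Lcm\<close> of their moduli, so adding one more is a case of
  \<open>two_congruences\<close>.\<close>

lemma simultaneous_congruences:
  fixes a r :: "'i \<Rightarrow> int"
  assumes "finite I" "\<And>i j. i \<in> I \<Longrightarrow> j \<in> I \<Longrightarrow> gcd (r i) (r j) dvd a i - a j"
  shows "\<exists>z. \<forall>i\<in>I. r i dvd z - a i"
  using assms
proof (induction I)
  case (insert i I)
  then obtain z where z: "\<forall>j\<in>I. r j dvd z - a j"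
    by blast
  have compat: "gcd (r j) (r i) dvd a j - a i" if "j \<in> I" for j
    using insert.prems that by blast
  \<comment> \<open>The \<open>Lcm\<close> is built up one modulus at a time with \<open>z\<close>
    held fixed. Since gcd distributes over lcm, only the gcd of \<open>r i\<close> with each single
    \<open>r j\<close> matters.\<close>
  have "gcd (Lcm (r ` J)) (r i) dvd z - a i" if "J \<subseteq> I" for J
    using finite_subset[OF that \<open>finite I\<close>] that
  proof (induction J)
    case (insert j J)
    have "gcd (r j) (r i) dvd (z - a j) + (a j - a i)"
      using z insert.prems compat
      by (intro dvd_add) (auto intro: dvd_trans[OF gcd_dvd1])
    then show ?case
      using insert by (simp add: gcd.commute[of _ "r i"] gcd_lcm_distrib)
  qed simp
  then have "gcd (Lcm (r ` I)) (r i) dvd z - a i"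
    by blast
  then obtain z' where "Lcm (r ` I) dvd z' - z" "r i dvd z' - a i"
    by (rule two_congruences)
  moreover have "r j dvd z' - a j" if "j \<in> I" for j
  proof -
    have "r j dvd (z' - z) + (z - a j)"
      using that z \<open>Lcm (r ` I) dvd z' - z\<close> by (intro dvd_add) (auto simp: Lcm_dvd_iff)
    then show ?thesis
      by simp
  qed
  ultimately show ?case
    by blast
qed simp

text \<open>The invariant carried through the reductions: finiteness feeds the remainder theorem,
  and \<open>card e = 2\<close> excludes loops, which \<open>{u, w}\<close> with
  \<open>u = w\<close> would denote.\<close>

definition finite_simple_graph :: "'a lgraph \<Rightarrow> bool" where
  "finite_simple_graph G \<longleftrightarrow>
     finite (verts G) \<and> (\<forall>e\<in>edges G. e \<subseteq> verts G \<and> card e = 2)"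

lemma finite_simple_graph_loopless:
  assumes "finite_simple_graph G"
  shows "{x} \<notin> edges G"
  using assms by (auto simp: finite_simple_graph_def)

lemma finite_simple_graph_edgeD:
  assumes "finite_simple_graph G" "{u, w} \<in> edges G"
  shows "u \<in> verts G" "w \<in> verts G" "u \<noteq> w"
  using assms by (auto simp: finite_simple_graph_def)

lemma finite_simple_graph_reduced_graph:
  assumes "finite_simple_graph G"
  shows "finite_simple_graph (reduced_graph G x)"
proof -
  have "e \<subseteq> verts G - {x} \<and> card e = 2" if ne: "parallel_labels G x e \<noteq> {}" for e
  proof (cases "e \<in> edges G \<and> x \<notin> e")
    case True
    then show ?thesis
      using assms by (auto simp: finite_simple_graph_def)
  next
    case False
    then obtain w w' where "w \<noteq> w'" "{x, w} \<in> edges G" "{x, w'} \<in> edges G" "e = {w, w'}"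
      using ne by (auto simp: parallel_labels_def)
    then show ?thesis
      using finite_simple_graph_edgeD[OF assms, of x w] finite_simple_graph_edgeD[OF assms, of x w']
      by auto
  qed
  then show ?thesis
    using assms by (auto simp: finite_simple_graph_def reduced_graph_def)
qed

lemma splines_iff:
  "f \<in> splines G \<longleftrightarrow> f \<in> extensional (verts G) \<and> (\<forall>w\<in>verts G. vlab G w dvd f w) \<and>
     (\<forall>u w. {u, w} \<in> edges G \<longrightarrow> elab G {u, w} dvd f u - f w)"
  by (auto simp: splines_def mem_multiples_iff PiE_iff)

text \<open>An lcm divides a number iff all its arguments do, so the merged labels of the reduced
  graph dissolve into separate divisibilities by labels of \<open>G\<close> and their gcds.\<close>

lemma splines_reduced_graph_iff:
  assumes "finite_simple_graph G"
  shows "f \<in> splines (reduced_graph G x) \<longleftrightarrow> f \<in> extensional (verts G - {x}) \<and>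
     (\<forall>w\<in>verts G - {x}. vlab G w dvd f w \<and>
       ({x, w} \<in> edges G \<longrightarrow> gcd (vlab G x) (elab G {x, w}) dvd f w)) \<and>
     (\<forall>u w. {u, w} \<in> edges G \<longrightarrow> u \<noteq> x \<longrightarrow> w \<noteq> x \<longrightarrow> elab G {u, w} dvd f u - f w) \<and>
     (\<forall>u w. {x, u} \<in> edges G \<longrightarrow> {x, w} \<in> edges G \<longrightarrow> u \<noteq> w \<longrightarrow>
       gcd (elab G {x, u}) (elab G {x, w}) dvd f u - f w)"
proof -
  \<comment> \<open>For a non-edge the set of parallel labels is empty, so the edge condition is
    absorbed into the bounded quantifier.\<close>
  have "(\<forall>u w. {u, w} \<in> edges (reduced_graph G x) \<longrightarrow>
          elab (reduced_graph G x) {u, w} dvd f u - f w) \<longleftrightarrow>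
        (\<forall>u w. \<forall>r\<in>parallel_labels G x {u, w}. r dvd f u - f w)"
    by (auto simp: reduced_graph_def Lcm_dvd_iff)
  also have "\<dots> \<longleftrightarrow>
     (\<forall>u w. {u, w} \<in> edges G \<longrightarrow> u \<noteq> x \<longrightarrow> w \<noteq> x \<longrightarrow> elab G {u, w} dvd f u - f w) \<and>
     (\<forall>u w. {x, u} \<in> edges G \<longrightarrow> {x, w} \<in> edges G \<longrightarrow> u \<noteq> w \<longrightarrow>
       gcd (elab G {x, u}) (elab G {x, w}) dvd f u - f w)"
    (is "?L \<longleftrightarrow> ?R1 \<and> ?R2")
  proof
    assume L: ?L
    have ?R1
      using L by (fastforce simp: parallel_labels_def)
    moreover have ?R2
    proof (intro allI impI)
      fix u w assume "{x, u} \<in> edges G" "{x, w} \<in> edges G" "u \<noteq> w"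
      then have "gcd (elab G {x, u}) (elab G {x, w}) \<in> parallel_labels G x {u, w}"
        unfolding parallel_labels_def by blast
      then show "gcd (elab G {x, u}) (elab G {x, w}) dvd f u - f w"
        using L by blast
    qed
    ultimately show "?R1 \<and> ?R2" ..
  next
    assume R: "?R1 \<and> ?R2"
    \<comment> \<open>The endpoints may match in either order, which is harmless as gcd and
      divisibility of a difference are symmetric.\<close>
    have "r dvd f u - f w" if "r \<in> parallel_labels G x {u, w}" for u w r
      using that R finite_simple_graph_loopless[OF assms]
      by (auto simp: parallel_labels_def doubleton_eq_iff gcd.commute dvd_diff_commute
          split: if_splits)
    then show ?L
      by blast
  qed
  finally show ?thesis
    by (auto simp: splines_iff reduced_graph_def)
qed

text \<open>The new conditions arise by eliminating \<open>f x\<close>: both \<open>f w\<close> and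
  \<open>f u - f w\<close> are differences of two terms containing \<open>f x\<close>, each
  divisible by the gcd in question.\<close>

lemma restrict_in_splines_reduced_graph:
  assumes G: "finite_simple_graph G" and f: "f \<in> splines G"
  shows "restrict f (verts G - {x}) \<in> splines (reduced_graph G x)"
proof -
  have vf: "vlab G w dvd f w" if "w \<in> verts G" for w
    using f that by (simp add: splines_iff)
  have ef: "elab G {u, w} dvd f u - f w" if "{u, w} \<in> edges G" for u w
    using f that by (simp add: splines_iff)
  have "gcd (vlab G x) (elab G {x, w}) dvd f w" if "{x, w} \<in> edges G" for w
  proof -
    have "gcd (vlab G x) (elab G {x, w}) dvd f x - (f x - f w)"
      using dvd_trans[OF gcd_dvd1 vf[of x]] dvd_trans[OF gcd_dvd2 ef[OF that]]
        finite_simple_graph_edgeD[OF G that] by (simp only: dvd_diff)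
    then show ?thesis
      by simp
  qed
  moreover have "gcd (elab G {x, u}) (elab G {x, w}) dvd f u - f w"
    if "{x, u} \<in> edges G" "{x, w} \<in> edges G" for u w
  proof -
    have "gcd (elab G {x, u}) (elab G {x, w}) dvd (f x - f w) - (f x - f u)"
      using dvd_trans[OF gcd_dvd1 ef[OF that(1)]] dvd_trans[OF gcd_dvd2 ef[OF that(2)]]
      by (simp only: dvd_diff)
    then show ?thesis
      by simp
  qed
  ultimately show ?thesis
    unfolding splines_reduced_graph_iff[OF G]
    using vf ef finite_simple_graph_edgeD[OF G] finite_simple_graph_loopless[OF G] by auto
qed

lemma spline_reduced_graph_extends:
  assumes G: "finite_simple_graph G" and x: "x \<in> verts G"
    and f: "f \<in> splines (reduced_graph G x)"
  shows "\<exists>z. f(x := z) \<in> splines G"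
proof -
  define I where "I = {w. {x, w} \<in> edges G}"
  have I: "I \<subseteq> verts G" "x \<notin> I"
    using finite_simple_graph_edgeD[OF G] unfolding I_def by blast+
  note f' = f[unfolded splines_reduced_graph_iff[OF G]]
  text \<open>The index \<open>x\<close>, which is not a neighbour of itself, stands for the congruence modulo
    the label of \<open>x\<close>.\<close>
  define r where "r w = (if w = x then vlab G x else elab G {x, w})" for w
  define a where "a w = (if w = x then 0 else f w)" for w
  have "finite (insert x I)"
    using I G by (auto simp: finite_simple_graph_def intro: finite_subset)
  \<comment> \<open>Two distinct neighbours use the new edge label, a neighbour paired with
    \<open>x\<close> the new vertex label; for \<open>u = w\<close> the difference is 0.\<close>
  moreover have "gcd (r u) (r w) dvd a u - a w" if "u \<in> insert x I" "w \<in> insert x I" for u w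
    using that f' I by (cases "u = w") (auto simp: r_def a_def I_def gcd.commute)
  ultimately obtain z where z: "\<forall>w\<in>insert x I. r w dvd z - a w"
    using simultaneous_congruences by metis
  have zx: "vlab G x dvd z"
    using z by (auto simp: r_def a_def)
  have zI: "elab G {x, w} dvd z - f w" if "{x, w} \<in> edges G" for w
    using z that I by (auto simp: r_def a_def I_def split: if_splits)
  have "elab G {u, w} dvd (f(x := z)) u - (f(x := z)) w" if "{u, w} \<in> edges G" for u w
    using that f' zI[of w] zI[of u]
    by (auto simp: insert_commute dvd_diff_commute)
  then have "f(x := z) \<in> splines G"
    using f' zx x by (auto simp: splines_iff extensional_def)
  then show ?thesis ..
qed

lemma splines_reduced_graph:
  assumes "finite_simple_graph G" "x \<in> verts G"
  shows "splines (reduced_graph G x) = (\<lambda>f. restrict f (verts G - {x})) ` splines G"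
proof (intro equalityI subsetI)
  fix f assume f: "f \<in> splines (reduced_graph G x)"
  then obtain z where z: "f(x := z) \<in> splines G"
    using spline_reduced_graph_extends[OF assms] by blast
  \<comment> \<open>As \<open>f\<close> is extensional on \<open>verts G - {x}\<close>, it is
    \<open>undefined\<close> at \<open>x\<close>, and restricting undoes the update.\<close>
  have "f = restrict (f(x := z)) (verts G - {x})"
    using f by (auto simp: splines_reduced_graph_iff[OF assms(1)] extensional_def restrict_def)
  then show "f \<in> (\<lambda>f. restrict f (verts G - {x})) ` splines G"
    using z by (rule image_eqI)
qed (auto intro: restrict_in_splines_reduced_graph assms)

text \<open>Induction on \<open>n\<close> upwards from \<open>i\<close>, with \<open>G\<close>
  arbitrary: the first reduction removes the last vertex and leaves a graph enumerated by one vertex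
  fewer.\<close>

lemma splines_successive_reduction:
  assumes "finite_simple_graph G" "bij_betw v {1..n} (verts G)" "i \<le> n"
  shows "splines (successive_reduction G v n i) = spline_projection v i ` splines G"
  using \<open>i \<le> n\<close> assms(1,2)
proof (induction n arbitrary: G rule: dec_induct)
  case base
  \<comment> \<open>With \<open>n = i\<close> nothing is reduced, and the projection fixes every
    spline because splines are extensional on the vertex set.\<close>
  then have "v ` {1..i} = verts G"
    by (simp add: bij_betw_def)
  then have "spline_projection v i f = f" if "f \<in> splines G" for f
    using that by (simp add: spline_projection_def splines_iff extensional_restrict)
  then show ?case
    by (simp add: successive_reduction_def)
next
  case (step n)
  let ?x = "v (Suc n)" and ?H = "reduced_graph G (v (Suc n))"
  have split: "{1..Suc n} = insert (Suc n) {1..n}"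
    by auto
  have inj: "inj_on v {1..Suc n}" and img: "v ` {1..Suc n} = verts G"
    using step.prems by (auto simp: bij_betw_def)
  have x: "?x \<in> verts G"
    using img by (metis atLeastAtMost_iff imageI le_add1 le_refl plus_1_eq_Suc)
  have "?x \<notin> v ` {1..n}"
    using inj unfolding split inj_on_insert by simp
  then have verts: "v ` {1..n} = verts G - {?x}"
    using img unfolding split by blast
  then have "bij_betw v {1..n} (verts ?H)"
    using inj_on_subset[OF inj, of "{1..n}"] by (simp add: bij_betw_def reduced_graph_def)
  then have IH: "splines (successive_reduction ?H v n i) = spline_projection v i ` splines ?H"
    by (rule step.IH[OF finite_simple_graph_reduced_graph[OF step.prems(1)]])
  \<comment> \<open>Since \<open>i \<le> n\<close>, the reversed index list starts with
    \<open>Suc n\<close>.\<close>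
  have "successive_reduction G v (Suc n) i = successive_reduction ?H v n i"
    using step.hyps by (simp add: successive_reduction_def)
  moreover have "spline_projection v i (restrict f (verts G - {?x})) = spline_projection v i f" for f
  proof -
    have "(verts G - {?x}) \<inter> v ` {1..i} = v ` {1..i}"
      using step.hyps unfolding verts[symmetric] by auto
    then show ?thesis
      by (simp add: spline_projection_def)
  qed
  ultimately show ?case
    using IH splines_reduced_graph[OF step.prems(1) x] by (simp add: image_image)
qed

theorem theorem4p7:
  fixes G :: "'a lgraph" and v :: "nat \<Rightarrow> 'a" and n i :: nat and F :: "'a \<Rightarrow> int"
  assumes "finite_connected_simple_graph G"
    and "bij_betw v {1..n} (verts G)"
    and "1 \<le> i" and "i \<le> n"
    and "flow_up_class G v i F"
  shows "minimal_flow_up_class G v i F \<longleftrightarrow>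
    minimal_flow_up_class (successive_reduction G v n i) v i (spline_projection v i F)"
proof -
  let ?H = "successive_reduction G v n i" and ?p = "spline_projection v i"
  have "finite_simple_graph G"
    using assms(1) by (simp add: finite_connected_simple_graph_def finite_simple_graph_def)
  then have spl: "splines ?H = ?p ` splines G"
    using splines_successive_reduction assms(2,4) by blast
  have p: "?p f (v s) = f (v s)" if "s \<in> {1..i}" for f s
    using that by (simp add: spline_projection_def)
  have proj: "flow_up_class ?H v i (?p f) \<longleftrightarrow> flow_up_class G v i f" if "f \<in> splines G" for f
    using that spl p \<open>1 \<le> i\<close> by (auto simp: flow_up_class_def)
  \<comment> \<open>Every spline of \<open>?H\<close> is a projection, and projecting keeps the
    entries at \<open>v 1\<close> to \<open>v i\<close>, the only ones that decide being a flow-up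
    class and its leading term.\<close>
  have "{h (v i) | h. flow_up_class ?H v i h} = {f (v i) | f. flow_up_class G v i f}"
  proof -
    have "{h (v i) | h. flow_up_class ?H v i h} =
        {?p f (v i) | f. f \<in> splines G \<and> flow_up_class ?H v i (?p f)}"
      using spl by (auto simp: flow_up_class_def)
    also have "\<dots> = {f (v i) | f. flow_up_class G v i f}"
      using proj p[of i] \<open>1 \<le> i\<close> by (auto simp: flow_up_class_def)
    finally show ?thesis .
  qed
  \<comment> \<open>Both minimality claims now compare the same leading term with the same
    ideal.\<close>
  then show ?thesis
    using assms(3,5) proj[of F] p[of i F]
    by (simp add: minimal_flow_up_class_def leading_ideal_def) (simp add: flow_up_class_def)
qed

end
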